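(* Let $(T,\mu,\eta,c,u)$ be a relevant monad on a gs-monoidal category $\mathcal{C}$. If $\mathcal{C}$ has diagonals, then so does the Kleisli category $\mathcal{C}_T$.
   Context: Coherence isomorphisms of monoidal structures are suppressed; $\gamma$ denotes the braiding. A gs-monoidal category is a symmetric monoidal category $(\mathcal{C},\otimes,I)$ together with, for every object $X$, arrows $\nabla_X\colon X\to X\otimes X$ and $!_X\colon X\to I$ making $X$ a commutative comonoid, with $\nabla_{X\otimes Y}=(\mathrm{id}_X\otimes\gamma_{X,Y}\otimes\mathrm{id}_Y)\circ(\nabla_X\otimes\nabla_Y)$, $\nabla_I=\mathrm{id}_I$, $!_{X\otimes Y}=\,!_X\otimes !_Y$, $!_I=\mathrm{id}_I$ (no naturality required). It has diagonals if $\nabla$ is natural, i.e. $\nabla_Y\circ f=(f\otimes f)\circ\nabla_X$ for every $f\colon X\to Y$. A symmetric monoidal monad $(T,\mu,\eta,c,u)$ on a symmetric monoidal category $\mathcal{C}$ is a monad $(T,\mu,\eta)$ together with a lax symmetric monoidal structure on $T$ given by $c_{X,Y}\colon TX\otimes TY\to T(X\otimes Y)$ (natural) and $u\colon I\to TI$, such that $u=\eta_I$, $c_{X,Y}\circ(\eta_X\otimes\eta_Y)=\eta_{X\otimes Y}$, and $\mu_{X\otimes Y}\circ T(c_{X,Y})\circ c_{TX,TY}=c_{X,Y}\circ(\mu_X\otimes\mu_Y)$. On a gs-monoidal category, such a monad is relevant if $T(\nabla_X)=c_{X,X}\circ\nabla_{TX}$ for all objects $X$. The Kleisli category $\mathcal{C}_T$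 is regarded as a gs-monoidal category with: $X\otimes^\sharp Y:=X\otimes Y$ on objects; $f\otimes^\sharp g:=c_{X',Y'}\circ(f\otimes g)$ for Kleisli arrows $f\colon X\to TX'$, $g\colon Y\to TY'$; unit $I$; structural isomorphisms those of $\mathcal{C}$ postcomposed with $\eta$; $\nabla^\sharp_X:=\eta_{X\otimes X}\circ\nabla_X$ and $!^\sharp_X:=\eta_I\circ !_X$. *)

theory Defs
  imports Main
begin

section \<open>Categories\<close>

record ('o, 'a) category_data =
  Obj :: "'o set"
  Arr :: "'a set"
  Dom :: "'a \<Rightarrow> 'o"
  Cod :: "'a \<Rightarrow> 'o"
  Id :: "'o \<Rightarrow> 'a" ("\<one>\<index>")
  Comp :: "'a \<Rightarrow> 'a \<Rightarrow> 'a" (infixr "\<cdot>\<index>" 55)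

definition hom :: "('o, 'a, 'm) category_data_scheme \<Rightarrow> 'o \<Rightarrow> 'o \<Rightarrow> 'a set" where
  "hom C X Y = {f \<in> Arr C. Dom C f = X \<and> Cod C f = Y}"

locale category =
  fixes C :: "('o, 'a, 'm) category_data_scheme" (structure)
  assumes Dom_Obj: "f \<in> Arr C \<Longrightarrow> Dom C f \<in> Obj C"
    and Cod_Obj: "f \<in> Arr C \<Longrightarrow> Cod C f \<in> Obj C"
    and Id_hom: "X \<in> Obj C \<Longrightarrow> \<one> X \<in> hom C X X"
    and Comp_hom: "\<lbrakk>f \<in> hom C X Y; g \<in> hom C Y Z\<rbrakk> \<Longrightarrow> g \<cdot> f \<in> hom C X Z"
    and Id_left: "f \<in> hom C X Y \<Longrightarrow> \<one> Y \<cdot> f = f"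
    and Id_right: "f \<in> hom C X Y \<Longrightarrow> f \<cdot> \<one> X = f"
    and Comp_assoc: "\<lbrakk>f \<in> hom C W X; g \<in> hom C X Y; h \<in> hom C Y Z\<rbrakk>
          \<Longrightarrow> (h \<cdot> g) \<cdot> f = h \<cdot> (g \<cdot> f)"

definition inverse_arrows :: "('o, 'a, 'm) category_data_scheme \<Rightarrow> 'a \<Rightarrow> 'a \<Rightarrow> bool" where
  "inverse_arrows C f g \<longleftrightarrow> f \<in> Arr C \<and> g \<in> hom C (Cod C f) (Dom C f)
     \<and> g \<cdot>\<^bsub>C\<^esub> f = \<one>\<^bsub>C\<^esub> (Dom C f) \<and> f \<cdot>\<^bsub>C\<^esub> g = \<one>\<^bsub>C\<^esub> (Cod C f)"

definition iso :: "('o, 'a, 'm) category_data_scheme \<Rightarrow> 'a \<Rightarrow> bool" where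
  "iso C f \<longleftrightarrow> (\<exists>g. inverse_arrows C f g)"

definition inv_arr :: "('o, 'a, 'm) category_data_scheme \<Rightarrow> 'a \<Rightarrow> 'a" where
  "inv_arr C f = (THE g. inverse_arrows C f g)"


section \<open>Symmetric monoidal categories\<close>

text \<open>Monoidal categories are not assumed strict.  The structural isomorphisms have types
  \<open>\<alpha> X Y Z : (X \<boxtimes> Y) \<boxtimes> Z \<rightarrow> X \<boxtimes> (Y \<boxtimes> Z)\<close>, \<open>\<l> X : I \<boxtimes> X \<rightarrow> X\<close>, \<open>\<rho> X : X \<boxtimes> I \<rightarrow> X\<close> and
  \<open>\<gamma> X Y : X \<boxtimes> Y \<rightarrow> Y \<boxtimes> X\<close>.  The tensor product is written \<open>\<boxtimes>\<close> on objects and \<open>\<otimes>\<close> on arrows.\<close>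

record ('o, 'a) monoidal_data = "('o, 'a) category_data" +
  tensor_obj :: "'o \<Rightarrow> 'o \<Rightarrow> 'o" (infixr "\<boxtimes>\<index>" 60)
  tensor :: "'a \<Rightarrow> 'a \<Rightarrow> 'a" (infixr "\<otimes>\<index>" 60)
  unit_obj :: "'o" ("\<I>\<index>")
  associator :: "'o \<Rightarrow> 'o \<Rightarrow> 'o \<Rightarrow> 'a" ("\<alpha>\<index>")
  left_unitor :: "'o \<Rightarrow> 'a" ("\<l>\<index>")
  right_unitor :: "'o \<Rightarrow> 'a" ("\<rho>\<index>")
  braiding :: "'o \<Rightarrow> 'o \<Rightarrow> 'a" ("\<gamma>\<index>")

locale symmetric_monoidal_category = category C
  for C :: "('o, 'a, 'm) monoidal_data_scheme" (structure) +
  assumes tensor_obj: "\<lbrakk>X \<in> Obj C; Y \<in> Obj C\<rbrakk> \<Longrightarrow> X \<boxtimes> Y \<in> Obj C"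
    and tensor_hom: "\<lbrakk>f \<in> hom C X X'; g \<in> hom C Y Y'\<rbrakk> \<Longrightarrow> f \<otimes> g \<in> hom C (X \<boxtimes> Y) (X' \<boxtimes> Y')"
    and tensor_Id: "\<lbrakk>X \<in> Obj C; Y \<in> Obj C\<rbrakk> \<Longrightarrow> \<one> X \<otimes> \<one> Y = \<one> (X \<boxtimes> Y)"
    and tensor_Comp: "\<lbrakk>f \<in> hom C X X'; f' \<in> hom C X' X''; g \<in> hom C Y Y'; g' \<in> hom C Y' Y''\<rbrakk>
          \<Longrightarrow> (f' \<cdot> f) \<otimes> (g' \<cdot> g) = (f' \<otimes> g') \<cdot> (f \<otimes> g)"
    and unit_Obj: "\<I> \<in> Obj C"
    and assoc_hom: "\<lbrakk>X \<in> Obj C; Y \<in> Obj C; Z \<in> Obj C\<rbrakk>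
          \<Longrightarrow> \<alpha> X Y Z \<in> hom C ((X \<boxtimes> Y) \<boxtimes> Z) (X \<boxtimes> (Y \<boxtimes> Z))"
    and assoc_iso: "\<lbrakk>X \<in> Obj C; Y \<in> Obj C; Z \<in> Obj C\<rbrakk> \<Longrightarrow> iso C (\<alpha> X Y Z)"
    and assoc_natural: "\<lbrakk>f \<in> hom C X X'; g \<in> hom C Y Y'; h \<in> hom C Z Z'\<rbrakk>
          \<Longrightarrow> \<alpha> X' Y' Z' \<cdot> ((f \<otimes> g) \<otimes> h) = (f \<otimes> (g \<otimes> h)) \<cdot> \<alpha> X Y Z"
    and left_unitor_hom: "X \<in> Obj C \<Longrightarrow> \<l> X \<in> hom C (\<I> \<boxtimes> X) X"
    and left_unitor_iso: "X \<in> Obj C \<Longrightarrow> iso C (\<l> X)"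
    and left_unitor_natural: "f \<in> hom C X Y \<Longrightarrow> \<l> Y \<cdot> (\<one> \<I> \<otimes> f) = f \<cdot> \<l> X"
    and right_unitor_hom: "X \<in> Obj C \<Longrightarrow> \<rho> X \<in> hom C (X \<boxtimes> \<I>) X"
    and right_unitor_iso: "X \<in> Obj C \<Longrightarrow> iso C (\<rho> X)"
    and right_unitor_natural: "f \<in> hom C X Y \<Longrightarrow> \<rho> Y \<cdot> (f \<otimes> \<one> \<I>) = f \<cdot> \<rho> X"
    and braiding_hom: "\<lbrakk>X \<in> Obj C; Y \<in> Obj C\<rbrakk> \<Longrightarrow> \<gamma> X Y \<in> hom C (X \<boxtimes> Y) (Y \<boxtimes> X)"
    and braiding_natural: "\<lbrakk>f \<in> hom C X X'; g \<in> hom C Y Y'\<rbrakk>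
          \<Longrightarrow> \<gamma> X' Y' \<cdot> (f \<otimes> g) = (g \<otimes> f) \<cdot> \<gamma> X Y"
    and pentagon: "\<lbrakk>W \<in> Obj C; X \<in> Obj C; Y \<in> Obj C; Z \<in> Obj C\<rbrakk>
          \<Longrightarrow> (\<one> W \<otimes> \<alpha> X Y Z) \<cdot> \<alpha> W (X \<boxtimes> Y) Z \<cdot> (\<alpha> W X Y \<otimes> \<one> Z)
            = \<alpha> W X (Y \<boxtimes> Z) \<cdot> \<alpha> (W \<boxtimes> X) Y Z"
    and triangle: "\<lbrakk>X \<in> Obj C; Y \<in> Obj C\<rbrakk>
          \<Longrightarrow> (\<one> X \<otimes> \<l> Y) \<cdot> \<alpha> X \<I> Y = \<rho> X \<otimes> \<one> Y"
    and hexagon: "\<lbrakk>X \<in> Obj C; Y \<in> Obj C; Z \<in> Obj C\<rbrakk>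
          \<Longrightarrow> \<alpha> Y Z X \<cdot> \<gamma> X (Y \<boxtimes> Z) \<cdot> \<alpha> X Y Z
            = (\<one> Y \<otimes> \<gamma> X Z) \<cdot> \<alpha> Y X Z \<cdot> (\<gamma> X Y \<otimes> \<one> Z)"
    and symmetry: "\<lbrakk>X \<in> Obj C; Y \<in> Obj C\<rbrakk> \<Longrightarrow> \<gamma> Y X \<cdot> \<gamma> X Y = \<one> (X \<boxtimes> Y)"

text \<open>The arrow \<open>(X \<boxtimes> X) \<boxtimes> (Y \<boxtimes> Y) \<rightarrow> (X \<boxtimes> Y) \<boxtimes> (X \<boxtimes> Y)\<close> that is written
  \<open>\<one> X \<otimes> \<gamma> X Y \<otimes> \<one> Y\<close> when the associators are suppressed.\<close>

definition middle_swap :: "('o, 'a, 'm) monoidal_data_scheme \<Rightarrow> 'o \<Rightarrow> 'o \<Rightarrow> 'a" where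
  "middle_swap C X Y =
     inv_arr C (associator C X Y (X \<boxtimes>\<^bsub>C\<^esub> Y))
     \<cdot>\<^bsub>C\<^esub> (\<one>\<^bsub>C\<^esub> X \<otimes>\<^bsub>C\<^esub> associator C Y X Y)
     \<cdot>\<^bsub>C\<^esub> (\<one>\<^bsub>C\<^esub> X \<otimes>\<^bsub>C\<^esub> (braiding C X Y \<otimes>\<^bsub>C\<^esub> \<one>\<^bsub>C\<^esub> Y))
     \<cdot>\<^bsub>C\<^esub> (\<one>\<^bsub>C\<^esub> X \<otimes>\<^bsub>C\<^esub> inv_arr C (associator C X Y Y))
     \<cdot>\<^bsub>C\<^esub> associator C X X (Y \<boxtimes>\<^bsub>C\<^esub> Y)"


section \<open>gs-monoidal categories\<close>

record ('o, 'a) gs_monoidal_data = "('o, 'a) monoidal_data" +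
  duplicator :: "'o \<Rightarrow> 'a" ("\<nabla>\<index>")
  discharger :: "'o \<Rightarrow> 'a" ("\<epsilon>\<index>")

text \<open>The discharger, commonly written with an exclamation mark, is \<open>\<epsilon> X : X \<rightarrow> I\<close>.\<close>

locale gs_monoidal_category = symmetric_monoidal_category C
  for C :: "('o, 'a, 'm) gs_monoidal_data_scheme" (structure) +
  assumes dup_hom: "X \<in> Obj C \<Longrightarrow> \<nabla> X \<in> hom C X (X \<boxtimes> X)"
    and dis_hom: "X \<in> Obj C \<Longrightarrow> \<epsilon> X \<in> hom C X \<I>"
    and dup_coassoc: "X \<in> Obj C \<Longrightarrow> \<alpha> X X X \<cdot> (\<nabla> X \<otimes> \<one> X) \<cdot> \<nabla> X = (\<one> X \<otimes> \<nabla> X) \<cdot> \<nabla> X"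
    and dup_counit_left: "X \<in> Obj C \<Longrightarrow> \<l> X \<cdot> (\<epsilon> X \<otimes> \<one> X) \<cdot> \<nabla> X = \<one> X"
    and dup_counit_right: "X \<in> Obj C \<Longrightarrow> \<rho> X \<cdot> (\<one> X \<otimes> \<epsilon> X) \<cdot> \<nabla> X = \<one> X"
    and dup_commutative: "X \<in> Obj C \<Longrightarrow> \<gamma> X X \<cdot> \<nabla> X = \<nabla> X"
    and dup_tensor: "\<lbrakk>X \<in> Obj C; Y \<in> Obj C\<rbrakk>
          \<Longrightarrow> \<nabla> (X \<boxtimes> Y) = middle_swap C X Y \<cdot> (\<nabla> X \<otimes> \<nabla> Y)"
    and dup_unit: "\<l> \<I> \<cdot> \<nabla> \<I> = \<one> \<I>"
    and dis_tensor: "\<lbrakk>X \<in> Obj C; Y \<in> Obj C\<rbrakk> \<Longrightarrow> \<epsilon> (X \<boxtimes> Y) = \<l> \<I> \<cdot> (\<epsilon> X \<otimes> \<epsilon> Y)"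
    and dis_unit: "\<epsilon> \<I> = \<one> \<I>"

definition has_diagonals :: "('o, 'a, 'm) gs_monoidal_data_scheme \<Rightarrow> bool" where
  "has_diagonals C \<longleftrightarrow> (\<forall>X \<in> Obj C. \<forall>Y \<in> Obj C. \<forall>f \<in> hom C X Y.
     duplicator C Y \<cdot>\<^bsub>C\<^esub> f = (f \<otimes>\<^bsub>C\<^esub> f) \<cdot>\<^bsub>C\<^esub> duplicator C X)"


section \<open>Symmetric monoidal monads\<close>

record ('o, 'a) monoidal_monad_data =
  obj_map :: "'o \<Rightarrow> 'o"
  arr_map :: "'a \<Rightarrow> 'a"
  mu :: "'o \<Rightarrow> 'a"
  eta :: "'o \<Rightarrow> 'a"
  lax :: "'o \<Rightarrow> 'o \<Rightarrow> 'a"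
  lax_unit :: "'a"

locale monad_on = category C
  for C :: "('o, 'a, 'm) category_data_scheme" (structure) +
  fixes T :: "('o, 'a, 'n) monoidal_monad_data_scheme"
  assumes T_Obj: "X \<in> Obj C \<Longrightarrow> obj_map T X \<in> Obj C"
    and T_hom: "f \<in> hom C X Y \<Longrightarrow> arr_map T f \<in> hom C (obj_map T X) (obj_map T Y)"
    and T_Id: "X \<in> Obj C \<Longrightarrow> arr_map T (\<one> X) = \<one> (obj_map T X)"
    and T_Comp: "\<lbrakk>f \<in> hom C X Y; g \<in> hom C Y Z\<rbrakk>
          \<Longrightarrow> arr_map T (g \<cdot> f) = arr_map T g \<cdot> arr_map T f"
    and mu_hom: "X \<in> Obj C \<Longrightarrow> mu T X \<in> hom C (obj_map T (obj_map T X)) (obj_map T X)"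
    and mu_natural: "f \<in> hom C X Y
          \<Longrightarrow> mu T Y \<cdot> arr_map T (arr_map T f) = arr_map T f \<cdot> mu T X"
    and eta_hom: "X \<in> Obj C \<Longrightarrow> eta T X \<in> hom C X (obj_map T X)"
    and eta_natural: "f \<in> hom C X Y \<Longrightarrow> eta T Y \<cdot> f = arr_map T f \<cdot> eta T X"
    and mu_assoc: "X \<in> Obj C \<Longrightarrow> mu T X \<cdot> arr_map T (mu T X) = mu T X \<cdot> mu T (obj_map T X)"
    and mu_eta: "X \<in> Obj C \<Longrightarrow> mu T X \<cdot> eta T (obj_map T X) = \<one> (obj_map T X)"
    and mu_T_eta: "X \<in> Obj C \<Longrightarrow> mu T X \<cdot> arr_map T (eta T X) = \<one> (obj_map T X)"

locale symmetric_monoidal_monad = symmetric_monoidal_category C + monad_on C T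
  for C :: "('o, 'a, 'm) monoidal_data_scheme" (structure)
    and T :: "('o, 'a, 'n) monoidal_monad_data_scheme" +
  assumes lax_hom: "\<lbrakk>X \<in> Obj C; Y \<in> Obj C\<rbrakk>
          \<Longrightarrow> lax T X Y \<in> hom C (obj_map T X \<boxtimes> obj_map T Y) (obj_map T (X \<boxtimes> Y))"
    and lax_natural: "\<lbrakk>f \<in> hom C X X'; g \<in> hom C Y Y'\<rbrakk>
          \<Longrightarrow> lax T X' Y' \<cdot> (arr_map T f \<otimes> arr_map T g) = arr_map T (f \<otimes> g) \<cdot> lax T X Y"
    and lax_unit_hom: "lax_unit T \<in> hom C \<I> (obj_map T \<I>)"
    and lax_assoc: "\<lbrakk>X \<in> Obj C; Y \<in> Obj C; Z \<in> Obj C\<rbrakk>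
          \<Longrightarrow> arr_map T (\<alpha> X Y Z) \<cdot> lax T (X \<boxtimes> Y) Z \<cdot> (lax T X Y \<otimes> \<one> (obj_map T Z))
            = lax T X (Y \<boxtimes> Z) \<cdot> (\<one> (obj_map T X) \<otimes> lax T Y Z)
                \<cdot> \<alpha> (obj_map T X) (obj_map T Y) (obj_map T Z)"
    and lax_left_unit: "X \<in> Obj C
          \<Longrightarrow> arr_map T (\<l> X) \<cdot> lax T \<I> X \<cdot> (lax_unit T \<otimes> \<one> (obj_map T X)) = \<l> (obj_map T X)"
    and lax_right_unit: "X \<in> Obj C
          \<Longrightarrow> arr_map T (\<rho> X) \<cdot> lax T X \<I> \<cdot> (\<one> (obj_map T X) \<otimes> lax_unit T) = \<rho> (obj_map T X)"
    and lax_symmetric: "\<lbrakk>X \<in> Obj C; Y \<in> Obj C\<rbrakk>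
          \<Longrightarrow> arr_map T (\<gamma> X Y) \<cdot> lax T X Y = lax T Y X \<cdot> \<gamma> (obj_map T X) (obj_map T Y)"
    and lax_unit_eta: "lax_unit T = eta T \<I>"
    and lax_eta: "\<lbrakk>X \<in> Obj C; Y \<in> Obj C\<rbrakk> \<Longrightarrow> lax T X Y \<cdot> (eta T X \<otimes> eta T Y) = eta T (X \<boxtimes> Y)"
    and lax_mu: "\<lbrakk>X \<in> Obj C; Y \<in> Obj C\<rbrakk>
          \<Longrightarrow> mu T (X \<boxtimes> Y) \<cdot> arr_map T (lax T X Y) \<cdot> lax T (obj_map T X) (obj_map T Y)
            = lax T X Y \<cdot> (mu T X \<otimes> mu T Y)"

locale relevant_monad = gs_monoidal_category C + symmetric_monoidal_monad C T
  for C :: "('o, 'a, 'm) gs_monoidal_data_scheme" (structure)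
    and T :: "('o, 'a, 'n) monoidal_monad_data_scheme" +
  assumes relevant: "X \<in> Obj C \<Longrightarrow> arr_map T (\<nabla> X) = lax T X X \<cdot> \<nabla> (obj_map T X)"


section \<open>The Kleisli category\<close>

text \<open>A Kleisli arrow from \<open>X\<close> to \<open>Y\<close> is a pair \<open>(Y, f)\<close> with \<open>f : X \<rightarrow> T Y\<close> in \<open>C\<close>; the object \<open>Y\<close>
  has to be recorded because \<open>T\<close> need not be injective on objects.\<close>

definition kleisli_lift ::
    "('o, 'a, 'm) category_data_scheme \<Rightarrow> ('o, 'a, 'n) monoidal_monad_data_scheme
      \<Rightarrow> 'a \<Rightarrow> 'o \<times> 'a" where
  "kleisli_lift C T f = (Cod C f, eta T (Cod C f) \<cdot>\<^bsub>C\<^esub> f)"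

definition kleisli ::
    "('o, 'a, 'm) gs_monoidal_data_scheme \<Rightarrow> ('o, 'a, 'n) monoidal_monad_data_scheme
      \<Rightarrow> ('o, 'o \<times> 'a) gs_monoidal_data" where
  "kleisli C T =
    \<lparr> Obj = Obj C,
      Arr = {(Y, f). Y \<in> Obj C \<and> f \<in> Arr C \<and> Cod C f = obj_map T Y},
      Dom = (\<lambda>(Y, f). Dom C f),
      Cod = (\<lambda>(Y, f). Y),
      Id = (\<lambda>X. (X, eta T X)),
      Comp = (\<lambda>(Z, g) (Y, f). (Z, mu T Z \<cdot>\<^bsub>C\<^esub> arr_map T g \<cdot>\<^bsub>C\<^esub> f)),
      tensor_obj = (\<lambda>X Y. X \<boxtimes>\<^bsub>C\<^esub> Y),
      tensor = (\<lambda>(X, f) (Y, g). (X \<boxtimes>\<^bsub>C\<^esub> Y, lax T X Y \<cdot>\<^bsub>C\<^esub> (f \<otimes>\<^bsub>C\<^esub> g))),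
      unit_obj = unit_obj C,
      associator = (\<lambda>X Y Z. kleisli_lift C T (associator C X Y Z)),
      left_unitor = (\<lambda>X. kleisli_lift C T (left_unitor C X)),
      right_unitor = (\<lambda>X. kleisli_lift C T (right_unitor C X)),
      braiding = (\<lambda>X Y. kleisli_lift C T (braiding C X Y)),
      duplicator = (\<lambda>X. kleisli_lift C T (duplicator C X)),
      discharger = (\<lambda>X. kleisli_lift C T (discharger C X)) \<rparr>"

context category
begin

lemma homI: "\<lbrakk>f \<in> Arr C; Dom C f = X; Cod C f = Y\<rbrakk> \<Longrightarrow> f \<in> hom C X Y"
  by (simp add: hom_def)

lemma homD: "f \<in> hom C X Y \<Longrightarrow> f \<in> Arr C \<and> Dom C f = X \<and> Cod C f = Y"
  by (simp add: hom_def)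

lemmas Id_arr [simp] = homD[OF Id_hom]

lemma Comp_arr [simp]:
  assumes "f \<in> Arr C" "g \<in> Arr C" "Dom C g = Cod C f"
  shows "g \<cdot> f \<in> Arr C" "Dom C (g \<cdot> f) = Dom C f" "Cod C (g \<cdot> f) = Cod C g"
  using Comp_hom[of f "Dom C f" "Cod C f" g "Cod C g"] assms by (auto simp: hom_def)

lemma Id_left' [simp]: "\<lbrakk>f \<in> Arr C; Cod C f = Y\<rbrakk> \<Longrightarrow> \<one> Y \<cdot> f = f"
  using Id_left by (auto simp: hom_def)

lemma Id_right' [simp]: "\<lbrakk>f \<in> Arr C; Dom C f = X\<rbrakk> \<Longrightarrow> f \<cdot> \<one> X = f"
  using Id_right by (auto simp: hom_def)

lemma Comp_assoc' [simp]:
  "\<lbrakk>f \<in> Arr C; g \<in> Arr C; h \<in> Arr C; Dom C g = Cod C f; Dom C h = Cod C g\<rbrakk>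
    \<Longrightarrow> (h \<cdot> g) \<cdot> f = h \<cdot> (g \<cdot> f)"
  by (rule Comp_assoc) (auto simp: hom_def)

lemma Comp_reassoc:
  assumes "g \<cdot> f = k" "f \<in> Arr C" "g \<in> Arr C" "h \<in> Arr C" "Dom C g = Cod C f" "Dom C f = Cod C h"
  shows "g \<cdot> (f \<cdot> h) = k \<cdot> h"
  using assms by (metis Comp_assoc')

lemma inv_arr_eqI:
  assumes "inverse_arrows C f g"
  shows "inv_arr C f = g"
  unfolding inv_arr_def
proof (rule the_equality[where P = "inverse_arrows C f", OF assms])
  fix h assume h: "inverse_arrows C f h"
  have "h = h \<cdot> (f \<cdot> g)"
    using assms h by (simp add: inverse_arrows_def hom_def)
  also have "\<dots> = (h \<cdot> f) \<cdot> g"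
    using assms h by (subst Comp_assoc') (auto simp: inverse_arrows_def hom_def)
  also have "\<dots> = g"
    using assms h by (simp add: inverse_arrows_def hom_def)
  finally show "h = g" .
qed

lemma inv_arr_inverse: "iso C f \<Longrightarrow> inverse_arrows C f (inv_arr C f)"
  using inv_arr_eqI by (auto simp: iso_def)

lemma inv_arr_arr [simp]:
  assumes "iso C f"
  shows "inv_arr C f \<in> Arr C" "Dom C (inv_arr C f) = Cod C f" "Cod C (inv_arr C f) = Dom C f"
  using inv_arr_inverse[OF assms] by (auto simp: inverse_arrows_def hom_def)

end

context symmetric_monoidal_category
begin

declare tensor_obj [simp] unit_Obj [simp]

lemmas structure_arr [simp] =
  homD[OF assoc_hom] homD[OF left_unitor_hom] homD[OF right_unitor_hom] homD[OF braiding_hom]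

lemma tensor_arr [simp]:
  assumes "f \<in> Arr C" "g \<in> Arr C"
  shows "f \<otimes> g \<in> Arr C" "Dom C (f \<otimes> g) = Dom C f \<boxtimes> Dom C g" "Cod C (f \<otimes> g) = Cod C f \<boxtimes> Cod C g"
  using tensor_hom[of f "Dom C f" "Cod C f" g "Dom C g" "Cod C g"] assms by (auto simp: hom_def)

lemma interchange:
  "\<lbrakk>f \<in> Arr C; f' \<in> Arr C; g \<in> Arr C; g' \<in> Arr C; Dom C f' = Cod C f; Dom C g' = Cod C g\<rbrakk>
    \<Longrightarrow> (f' \<otimes> g') \<cdot> (f \<otimes> g) = (f' \<cdot> f) \<otimes> (g' \<cdot> g)"
  by (rule tensor_Comp[symmetric]) (auto simp: hom_def)

end

context monad_on
begin

declare T_Obj [simp]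

lemmas monad_arr [simp] = homD[OF mu_hom] homD[OF eta_hom]

lemma T_arr [simp]:
  assumes "f \<in> Arr C"
  shows "arr_map T f \<in> Arr C" "Dom C (arr_map T f) = obj_map T (Dom C f)"
    "Cod C (arr_map T f) = obj_map T (Cod C f)"
  using T_hom[of f "Dom C f" "Cod C f"] assms by (auto simp: hom_def)

lemma T_Comp':
  "\<lbrakk>f \<in> Arr C; g \<in> Arr C; Dom C g = Cod C f\<rbrakk> \<Longrightarrow> arr_map T (g \<cdot> f) = arr_map T g \<cdot> arr_map T f"
  by (rule T_Comp) (auto simp: hom_def)

lemma eta_natural': "\<lbrakk>f \<in> Arr C; Cod C f = Y\<rbrakk> \<Longrightarrow> eta T Y \<cdot> f = arr_map T f \<cdot> eta T (Dom C f)"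
  by (rule eta_natural) (auto simp: hom_def)

lemma bind_eta:
  assumes "h \<in> Arr C" "Y \<in> Obj C" "Cod C h = obj_map T Y" "k \<in> Arr C" "Cod C k = Dom C h"
  shows "mu T Y \<cdot> arr_map T h \<cdot> eta T (Dom C h) \<cdot> k = h \<cdot> k"
proof -
  have "arr_map T h \<cdot> eta T (Dom C h) \<cdot> k = (eta T (obj_map T Y) \<cdot> h) \<cdot> k"
    using assms Dom_Obj by (subst eta_natural') auto
  then have "mu T Y \<cdot> arr_map T h \<cdot> eta T (Dom C h) \<cdot> k
      = (mu T Y \<cdot> eta T (obj_map T Y)) \<cdot> h \<cdot> k"
    using assms by simp
  then show ?thesis
    using assms by (simp only: mu_eta) simp
qed

lemma bind_lift:
  assumes "h \<in> Arr C" "a \<in> Arr C" "Cod C h = obj_map T (Dom C a)"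
  shows "mu T (Cod C a) \<cdot> arr_map T (eta T (Cod C a) \<cdot> a) \<cdot> h = arr_map T a \<cdot> h"
proof -
  have "mu T (Cod C a) \<cdot> arr_map T (eta T (Cod C a) \<cdot> a) \<cdot> h
      = (mu T (Cod C a) \<cdot> arr_map T (eta T (Cod C a))) \<cdot> arr_map T a \<cdot> h"
    using assms Cod_Obj by (simp add: T_Comp')
  then show ?thesis
    using assms Cod_Obj by (simp add: mu_T_eta)
qed

end

text \<open>The structure on \<open>kleisli C T\<close> is gs-monoidal.  The map \<open>kleisli_lift C T\<close> preserves all
  the structure of \<open>C\<close>, so every coherence equation is inherited from \<open>C\<close>.\<close>

locale gs_monoidal_monad = gs_monoidal_category C + symmetric_monoidal_monad C T
  for C :: "('o, 'a, 'm) gs_monoidal_data_scheme" (structure)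
    and T :: "('o, 'a, 'n) monoidal_monad_data_scheme"
begin

abbreviation "K \<equiv> kleisli C T"
abbreviation "F \<equiv> kleisli_lift C T"

lemmas gs_arr [simp] = homD[OF dup_hom] homD[OF dis_hom]
lemmas lax_arr [simp] = homD[OF lax_hom]

lemma K_simps [simp]:
  "Obj K = Obj C"
  "(Y, f) \<in> Arr K \<longleftrightarrow> Y \<in> Obj C \<and> f \<in> Arr C \<and> Cod C f = obj_map T Y"
  "Dom K (Y, f) = Dom C f"
  "Cod K (Y, f) = Y"
  "Id K X = (X, eta T X)"
  "Comp K (Z, g) (Y, f) = (Z, mu T Z \<cdot> arr_map T g \<cdot> f)"
  "tensor_obj K X Y = X \<boxtimes> Y"
  "tensor K (X, f) (Y, g) = (X \<boxtimes> Y, lax T X Y \<cdot> (f \<otimes> g))"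
  "unit_obj K = \<I>"
  "associator K X Y Z = F (\<alpha> X Y Z)"
  "left_unitor K X = F (\<l> X)"
  "right_unitor K X = F (\<rho> X)"
  "braiding K X Y = F (\<gamma> X Y)"
  "duplicator K X = F (\<nabla> X)"
  "discharger K X = F (\<epsilon> X)"
  by (simp_all add: kleisli_def)

lemma in_hom_K: "(W, f) \<in> hom K X Y \<longleftrightarrow> W = Y \<and> Y \<in> Obj C \<and> f \<in> hom C X (obj_map T Y)"
  by (auto simp: hom_def)

lemma F_arr [simp]:
  assumes "f \<in> Arr C"
  shows "F f \<in> Arr K" "Dom K (F f) = Dom C f" "Cod K (F f) = Cod C f"
  using assms Cod_Obj by (simp_all add: kleisli_lift_def)

lemma F_hom: "f \<in> hom C X Y \<Longrightarrow> F f \<in> hom K X Y"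
  by (auto simp: hom_def)

lemma F_Id: "X \<in> Obj C \<Longrightarrow> Id K X = F (\<one> X)"
  by (simp add: kleisli_lift_def)

lemma lift_Comp:
  "\<lbrakk>h \<in> Arr C; a \<in> Arr C; Cod C h = obj_map T (Dom C a)\<rbrakk>
    \<Longrightarrow> Comp K (F a) (Dom C a, h) = (Cod C a, arr_map T a \<cdot> h)"
  by (simp add: kleisli_lift_def bind_lift del: Comp_assoc')

lemma Comp_lift:
  "\<lbrakk>h \<in> Arr C; a \<in> Arr C; Z \<in> Obj C; Cod C h = obj_map T Z; Dom C h = Cod C a\<rbrakk>
    \<Longrightarrow> Comp K (Z, h) (F a) = (Z, h \<cdot> a)"
  using bind_eta[of h Z a] by (simp add: kleisli_lift_def del: Comp_assoc')

lemma F_Comp: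
  assumes "f \<in> Arr C" "g \<in> Arr C" "Dom C g = Cod C f"
  shows "Comp K (F g) (F f) = F (g \<cdot> f)"
  using assms Cod_Obj Comp_lift[of "eta T (Cod C g) \<cdot> g" f "Cod C g"]
  by (simp add: kleisli_lift_def)

lemma F_tensor:
  assumes "f \<in> Arr C" "g \<in> Arr C"
  shows "tensor K (F f) (F g) = F (f \<otimes> g)"
proof -
  have "lax T (Cod C f) (Cod C g) \<cdot> ((eta T (Cod C f) \<cdot> f) \<otimes> (eta T (Cod C g) \<cdot> g))
      = (lax T (Cod C f) (Cod C g) \<cdot> (eta T (Cod C f) \<otimes> eta T (Cod C g))) \<cdot> (f \<otimes> g)"
    using assms Cod_Obj by (simp add: interchange)
  then show ?thesis
    using assms Cod_Obj by (simp add: kleisli_lift_def lax_eta del: Comp_assoc')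
qed

lemma F_inverse:
  assumes "inverse_arrows C f g"
  shows "inverse_arrows K (F f) (F g)"
proof -
  have "f \<in> Arr C" "g \<in> Arr C" "Dom C g = Cod C f" "Cod C g = Dom C f"
       "g \<cdot> f = \<one> (Dom C f)" "f \<cdot> g = \<one> (Cod C f)"
    using assms by (auto simp: inverse_arrows_def hom_def)
  then show ?thesis
    using Dom_Obj Cod_Obj by (simp add: inverse_arrows_def hom_def F_Comp F_Id[symmetric] del: K_simps(5))
qed

lemma F_iso: "iso C f \<Longrightarrow> iso K (F f)"
  unfolding iso_def using F_inverse by blast

lemma category_K: "category K"
proof
  fix f assume "f \<in> Arr K"
  then show "Dom K f \<in> Obj K" "Cod K f \<in> Obj K"
    using Dom_Obj by (cases f; simp)+
next
  fix X assume "X \<in> Obj K"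
  then show "Id K X \<in> hom K X X"
    by (simp add: in_hom_K eta_hom)
next
  fix f g X Y Z assume "f \<in> hom K X Y" "g \<in> hom K Y Z"
  then show "Comp K g f \<in> hom K X Z"
    by (cases f; cases g) (auto simp: hom_def)
next
  fix f X Y assume f: "f \<in> hom K X Y"
  obtain f' where f': "f = (Y, f')" "Y \<in> Obj C" "f' \<in> hom C X (obj_map T Y)"
    using f by (cases f) (auto simp: in_hom_K)
  have X: "X \<in> Obj C" using f' Dom_Obj by (auto simp: hom_def)
  show "Comp K (Id K Y) f = f"
    using f' lift_Comp[of f' "\<one> Y"] by (simp add: F_Id hom_def T_Id del: K_simps(5))
  show "Comp K f (Id K X) = f"
    using f' X Comp_lift[of f' "\<one> X" Y] by (simp add: F_Id hom_def del: K_simps(5))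
next
  fix f g h W X Y Z assume *: "f \<in> hom K W X" "g \<in> hom K X Y" "h \<in> hom K Y Z"
  obtain f' g' h' where f: "f = (X, f')" "X \<in> Obj C" "f' \<in> hom C W (obj_map T X)"
    and g: "g = (Y, g')" "Y \<in> Obj C" "g' \<in> hom C X (obj_map T Y)"
    and h: "h = (Z, h')" "Z \<in> Obj C" "h' \<in> hom C Y (obj_map T Z)"
    using * by (cases f; cases g; cases h) (auto simp: in_hom_K)
  note D = homD[OF f(3)] homD[OF g(3)] homD[OF h(3)]
  have "mu T Z \<cdot> arr_map T (mu T Z \<cdot> arr_map T h' \<cdot> g') \<cdot> f'
      = (mu T Z \<cdot> arr_map T (mu T Z)) \<cdot> arr_map T (arr_map T h') \<cdot> arr_map T g' \<cdot> f'"
    using f g h D by (simp add: T_Comp')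
  also have "\<dots> = mu T Z \<cdot> (mu T (obj_map T Z) \<cdot> arr_map T (arr_map T h')) \<cdot> arr_map T g' \<cdot> f'"
    using f g h D by (simp add: mu_assoc)
  also have "\<dots> = mu T Z \<cdot> arr_map T h' \<cdot> mu T Y \<cdot> arr_map T g' \<cdot> f'"
    using f g h D by (subst mu_natural[OF h(3)]) simp
  finally show "Comp K (Comp K h g) f = Comp K h (Comp K g f)"
    using f g h by simp
qed

interpretation K: category K
  by (rule category_K)

lemma F_inv:
  assumes "iso C f"
  shows "inv_arr K (F f) = F (inv_arr C f)"
  using K.inv_arr_eqI F_inverse inv_arr_inverse assms by blast

lemmas F_simps = F_Comp F_tensor F_Id F_inv

lemma tensor_Comp_K:
  assumes *: "f \<in> hom K X X'" "f' \<in> hom K X' X''" "g \<in> hom K Y Y'" "g' \<in> hom K Y' Y''"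
  shows "tensor K (Comp K f' f) (Comp K g' g) = Comp K (tensor K f' g') (tensor K f g)"
proof -
  obtain a a' b b' where f: "f = (X', a)" "f' = (X'', a')" "g = (Y', b)" "g' = (Y'', b')"
    and O: "X' \<in> Obj C" "X'' \<in> Obj C" "Y' \<in> Obj C" "Y'' \<in> Obj C"
    and h: "a \<in> hom C X (obj_map T X')" "a' \<in> hom C X' (obj_map T X'')"
           "b \<in> hom C Y (obj_map T Y')" "b' \<in> hom C Y' (obj_map T Y'')"
    using * by (cases f; cases f'; cases g; cases g') (auto simp: in_hom_K)
  note D = h[THEN homD]
  have "lax T X'' Y'' \<cdot> ((mu T X'' \<cdot> arr_map T a' \<cdot> a) \<otimes> (mu T Y'' \<cdot> arr_map T b' \<cdot> b))
      = (lax T X'' Y'' \<cdot> (mu T X'' \<otimes> mu T Y'')) \<cdot> (arr_map T a' \<otimes> arr_map T b') \<cdot> (a \<otimes> b)"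
    using D O by (simp add: interchange)
  also have "\<dots> = mu T (X'' \<boxtimes> Y'') \<cdot> arr_map T (lax T X'' Y'')
      \<cdot> (lax T (obj_map T X'') (obj_map T Y'') \<cdot> (arr_map T a' \<otimes> arr_map T b')) \<cdot> (a \<otimes> b)"
    using D O by (simp add: lax_mu[symmetric])
  also have "\<dots> = mu T (X'' \<boxtimes> Y'') \<cdot> arr_map T (lax T X'' Y'' \<cdot> (a' \<otimes> b'))
      \<cdot> lax T X' Y' \<cdot> (a \<otimes> b)"
    using D O by (subst lax_natural[OF h(2,4)]) (simp add: T_Comp')
  finally show ?thesis
    using f by simp
qed

lemma assoc_natural_K:
  assumes *: "f \<in> hom K X X'" "g \<in> hom K Y Y'" "h \<in> hom K Z Z'"
  shows "Comp K (associator K X' Y' Z') (tensor K (tensor K f g) h)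
       = Comp K (tensor K f (tensor K g h)) (associator K X Y Z)"
proof -
  obtain a b c where f: "f = (X', a)" "g = (Y', b)" "h = (Z', c)"
    and O: "X' \<in> Obj C" "Y' \<in> Obj C" "Z' \<in> Obj C"
    and h: "a \<in> hom C X (obj_map T X')" "b \<in> hom C Y (obj_map T Y')" "c \<in> hom C Z (obj_map T Z')"
    using * by (cases f; cases g; cases h) (auto simp: in_hom_K)
  note D = h[THEN homD]
  have O': "X \<in> Obj C" "Y \<in> Obj C" "Z \<in> Obj C" using D Dom_Obj by blast+
  let ?l = "lax T (X' \<boxtimes> Y') Z' \<cdot> ((lax T X' Y' \<cdot> (a \<otimes> b)) \<otimes> c)"
  let ?r = "lax T X' (Y' \<boxtimes> Z') \<cdot> (a \<otimes> (lax T Y' Z' \<cdot> (b \<otimes> c)))"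
  have "arr_map T (\<alpha> X' Y' Z') \<cdot> ?l
      = (arr_map T (\<alpha> X' Y' Z') \<cdot> lax T (X' \<boxtimes> Y') Z' \<cdot> (lax T X' Y' \<otimes> \<one> (obj_map T Z')))
        \<cdot> ((a \<otimes> b) \<otimes> c)"
    using D O by (simp add: interchange)
  also have "\<dots> = lax T X' (Y' \<boxtimes> Z') \<cdot> (\<one> (obj_map T X') \<otimes> lax T Y' Z')
        \<cdot> \<alpha> (obj_map T X') (obj_map T Y') (obj_map T Z') \<cdot> ((a \<otimes> b) \<otimes> c)"
    using D O by (subst lax_assoc) auto
  also have "\<dots> = lax T X' (Y' \<boxtimes> Z') \<cdot> ((\<one> (obj_map T X') \<otimes> lax T Y' Z') \<cdot> (a \<otimes> (b \<otimes> c))) \<cdot> \<alpha> X Y Z"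
    using D O O' by (subst assoc_natural[OF h]) auto
  also have "\<dots> = ?r \<cdot> \<alpha> X Y Z"
    using D O O' by (simp add: interchange)
  finally show ?thesis
    using f D O O' lift_Comp[of ?l "\<alpha> X' Y' Z'"] Comp_lift[of ?r "\<alpha> X Y Z" "X' \<boxtimes> Y' \<boxtimes> Z'"]
    by simp
qed

lemma braiding_natural_K:
  assumes *: "f \<in> hom K X X'" "g \<in> hom K Y Y'"
  shows "Comp K (braiding K X' Y') (tensor K f g) = Comp K (tensor K g f) (braiding K X Y)"
proof -
  obtain a b where f: "f = (X', a)" "g = (Y', b)"
    and O: "X' \<in> Obj C" "Y' \<in> Obj C"
    and h: "a \<in> hom C X (obj_map T X')" "b \<in> hom C Y (obj_map T Y')"
    using * by (cases f; cases g) (auto simp: in_hom_K)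
  note D = h[THEN homD]
  have O': "X \<in> Obj C" "Y \<in> Obj C" using D Dom_Obj by blast+
  have "arr_map T (\<gamma> X' Y') \<cdot> lax T X' Y' \<cdot> (a \<otimes> b)
      = (arr_map T (\<gamma> X' Y') \<cdot> lax T X' Y') \<cdot> (a \<otimes> b)"
    using D O by simp
  also have "\<dots> = lax T Y' X' \<cdot> \<gamma> (obj_map T X') (obj_map T Y') \<cdot> (a \<otimes> b)"
    using D O by (subst lax_symmetric) auto
  also have "\<dots> = (lax T Y' X' \<cdot> (b \<otimes> a)) \<cdot> \<gamma> X Y"
    using D O O' by (subst braiding_natural[OF h]) auto
  finally show ?thesis
    using f D O O' lift_Comp[of "lax T X' Y' \<cdot> (a \<otimes> b)" "\<gamma> X' Y'"]
      Comp_lift[of "lax T Y' X' \<cdot> (b \<otimes> a)" "\<gamma> X Y" "Y' \<boxtimes> X'"]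
    by simp
qed

lemma left_unitor_natural_K:
  assumes *: "f \<in> hom K X Y"
  shows "Comp K (left_unitor K Y) (tensor K (Id K (unit_obj K)) f) = Comp K f (left_unitor K X)"
proof -
  obtain a where f: "f = (Y, a)" and O: "Y \<in> Obj C" and h: "a \<in> hom C X (obj_map T Y)"
    using * by (cases f) (auto simp: in_hom_K)
  note D = homD[OF h]
  have O': "X \<in> Obj C" using D Dom_Obj by blast
  have "arr_map T (\<l> Y) \<cdot> lax T \<I> Y \<cdot> (eta T \<I> \<otimes> a)
      = (arr_map T (\<l> Y) \<cdot> lax T \<I> Y \<cdot> (lax_unit T \<otimes> \<one> (obj_map T Y))) \<cdot> (\<one> \<I> \<otimes> a)"
    using D O by (simp add: interchange lax_unit_eta)
  also have "\<dots> = a \<cdot> \<l> X"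
    using D O by (simp add: lax_left_unit left_unitor_natural[OF h])
  finally show ?thesis
    using f D O O' lift_Comp[of "lax T \<I> Y \<cdot> (eta T \<I> \<otimes> a)" "\<l> Y"] Comp_lift[of a "\<l> X" Y]
    by simp
qed

lemma right_unitor_natural_K:
  assumes *: "f \<in> hom K X Y"
  shows "Comp K (right_unitor K Y) (tensor K f (Id K (unit_obj K))) = Comp K f (right_unitor K X)"
proof -
  obtain a where f: "f = (Y, a)" and O: "Y \<in> Obj C" and h: "a \<in> hom C X (obj_map T Y)"
    using * by (cases f) (auto simp: in_hom_K)
  note D = homD[OF h]
  have O': "X \<in> Obj C" using D Dom_Obj by blast
  have "arr_map T (\<rho> Y) \<cdot> lax T Y \<I> \<cdot> (a \<otimes> eta T \<I>)
      = (arr_map T (\<rho> Y) \<cdot> lax T Y \<I> \<cdot> (\<one> (obj_map T Y) \<otimes> lax_unit T)) \<cdot> (a \<otimes> \<one> \<I>)"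
    using D O by (simp add: interchange lax_unit_eta)
  also have "\<dots> = a \<cdot> \<rho> X"
    using D O by (simp add: lax_right_unit right_unitor_natural[OF h])
  finally show ?thesis
    using f D O O' lift_Comp[of "lax T Y \<I> \<cdot> (a \<otimes> eta T \<I>)" "\<rho> Y"] Comp_lift[of a "\<rho> X" Y]
    by simp
qed

lemma middle_swap_arr [simp]:
  assumes "X \<in> Obj C" "Y \<in> Obj C"
  shows "middle_swap C X Y \<in> Arr C" "Dom C (middle_swap C X Y) = (X \<boxtimes> X) \<boxtimes> (Y \<boxtimes> Y)"
    "Cod C (middle_swap C X Y) = (X \<boxtimes> Y) \<boxtimes> (X \<boxtimes> Y)"
  using assms assoc_iso by (simp_all add: middle_swap_def)

lemma middle_swap_K:
  assumes "X \<in> Obj C" "Y \<in> Obj C"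
  shows "middle_swap K X Y = F (middle_swap C X Y)"
  using assms assoc_iso by (simp add: middle_swap_def F_simps del: K_simps(5) Comp_assoc')

theorem gs_monoidal_category_kleisli: "gs_monoidal_category K"
proof (unfold_locales, goal_cases)
  case (2 f X X' g Y Y')
  then show ?case by (cases f; cases g) (auto simp: hom_def)
next
  case 4 then show ?case by (rule tensor_Comp_K)
next
  case 8 then show ?case by (rule assoc_natural_K)
next
  case 11 then show ?case by (rule left_unitor_natural_K)
next
  case 14 then show ?case by (rule right_unitor_natural_K)
next
  case 16 then show ?case by (rule braiding_natural_K)
qed (simp_all add: F_simps F_hom F_iso middle_swap_K tensor_Id
      assoc_hom assoc_iso left_unitor_hom left_unitor_iso right_unitor_hom right_unitor_iso
      braiding_hom pentagon triangle hexagon symmetry dup_hom dis_hom dup_coassoc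
      dup_counit_left dup_counit_right dup_commutative dup_tensor dup_unit dis_tensor dis_unit
      del: K_simps(5) Comp_assoc')

end

end

theory Submission
  imports Defs
begin

text \<open>A Kleisli arrow from \<open>X\<close> to \<open>Y\<close> is an arrow \<open>f : X \<rightarrow> T Y\<close> of \<open>C\<close>.  Naturality of
  \<open>\<nabla>\<close> in \<open>C\<close> applies to every such \<open>f\<close>, but it duplicates the whole computation: it ends in
  \<open>\<nabla> (T Y) : T Y \<rightarrow> T Y \<boxtimes> T Y\<close>, whereas duplication in the Kleisli category acts on the result
  inside \<open>T\<close>, by \<open>T (\<nabla> Y)\<close>.  Relevance says that the two agree once the pair of computations is
  recombined with \<open>lax\<close>, and \<open>lax \<cdot> (f \<otimes> f)\<close> is by definition the Kleisli tensor of \<open>f\<close> with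
  itself:
  \<open>T (\<nabla> Y) \<cdot> f = lax T Y Y \<cdot> \<nabla> (T Y) \<cdot> f = (lax T Y Y \<cdot> (f \<otimes> f)) \<cdot> \<nabla> X\<close>.
  The outer terms are the two Kleisli composites, because composing with the lift of an arrow
  \<open>a\<close> of \<open>C\<close> amounts to composing in \<open>C\<close> with \<open>T a\<close> on the left (\<open>lift_Comp\<close>) or with \<open>a\<close>
  on the right (\<open>Comp_lift\<close>).\<close>

sublocale relevant_monad \<subseteq> gs_monoidal_monad ..

context relevant_monad
begin

text \<open>Naturality of \<open>\<nabla>\<close> at the one arrow \<open>f\<close> of \<open>C\<close> already gives naturality at the Kleisli
  arrow that \<open>f\<close> represents.\<close>

lemma duplicator_K_natural_at:
  assumes Y: "Y \<in> Obj C"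
    and f: "f \<in> hom C X (obj_map T Y)"
    and natural: "\<nabla> (obj_map T Y) \<cdot> f = (f \<otimes> f) \<cdot> \<nabla> X"
  shows "Comp K (duplicator K Y) (Y, f) = Comp K (tensor K (Y, f) (Y, f)) (duplicator K X)"
proof -
  note f_arr = homD[OF f]
  have X: "X \<in> Obj C"
    using f_arr Dom_Obj by blast
  have "arr_map T (\<nabla> Y) \<cdot> f = lax T Y Y \<cdot> \<nabla> (obj_map T Y) \<cdot> f"
    using Y f_arr by (simp add: relevant)
  also have "\<dots> = (lax T Y Y \<cdot> (f \<otimes> f)) \<cdot> \<nabla> X"
    using X Y f_arr by (simp add: natural)
  finally show ?thesis
    using X Y f_arr lift_Comp[of f "\<nabla> Y"] Comp_lift[of "lax T Y Y \<cdot> (f \<otimes> f)" "\<nabla> X" "Y \<boxtimes> Y"]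
    by simp
qed

theorem has_diagonals_kleisli:
  assumes "has_diagonals C"
  shows "has_diagonals K"
  unfolding has_diagonals_def
proof (intro ballI)
  fix X Y f
  assume X: "X \<in> Obj K" and "Y \<in> Obj K" and "f \<in> hom K X Y"
  then obtain f' where f: "f = (Y, f')" and Y: "Y \<in> Obj C" and f': "f' \<in> hom C X (obj_map T Y)"
    by (cases f) (auto simp: in_hom_K)
  have "\<nabla> (obj_map T Y) \<cdot> f' = (f' \<otimes> f') \<cdot> \<nabla> X"
    using assms X Y f' by (auto simp: has_diagonals_def)
  then show "Comp K (duplicator K Y) f = Comp K (tensor K f f) (duplicator K X)"
    unfolding f by (rule duplicator_K_natural_at[OF Y f'])
qed

end

theorem proposition3p14:
  fixes C :: "('o, 'a) gs_monoidal_data"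
    and T :: "('o, 'a) monoidal_monad_data"
  assumes "gs_monoidal_category C"
    and "relevant_monad C T"
    and "has_diagonals C"
  shows "has_diagonals (kleisli C T)"
  using assms(2,3) by (rule relevant_monad.has_diagonals_kleisli)

end
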